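(* Consider the scalar system $$x_{k+1}=\tfrac32x_k+u_k,\qquad|u_k|\le1,\qquad x_0\sim\mathrm{Unif}[-1,1],$$ and, for $\beta\in(0,1]$ and $r\ge0$, the cost $J_{\beta,r}(\pi)=\mathbb{E}\sum_{k=0}^\infty\beta^k(x_k^2+ru_k^2)$ of a controller $\pi$. The static controller $u=1-\sigma(\frac32x+1)+\sigma(\frac32x-1)=-\mathrm{sat}(\frac32x)$ has cost $$J_{\beta,r}^{\rm NN}=\frac13+\frac{\beta}{36}+r\left(\frac59+\frac{\beta}{16}\right).$$ Every admissible finite-dimensional dynamic linear controller (defined in the context) satisfies $$J_{\beta,r}\ge\frac13+\frac r3+\frac{\beta}{12}$$ whenever $0\le r\le\beta/2$. Consequently, the static ReLU controller has strictly smaller cost than every admissible finite-dimensional dynamic linear controller whenever $$0\le r<\frac{8\beta}{32+9\beta}.$$ For $\beta=1$ this condition is $r<8/41$.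
   Context: $\sigma(r)=\max\{0,r\}$ and $\mathrm{sat}(r)=\max\{-1,\min\{r,1\}\}$. An admissible finite-dimensional dynamic linear controller is an LTI controller (of any order) $$\xi_{k+1}=A_c\xi_k+B_cx_k,\qquad u_k=C_c\xi_k+D_cx_k,$$ with a fixed initial controller state $\xi_0$ independent of $x_0$, such that in closed loop $|u_k|\le1$ for all $k\ge0$ and all $x_0\in[-1,1]$. Costs take values in $[0,+\infty]$. *)

theory Defs
  imports "HOL-Analysis.Analysis" "Jordan_Normal_Form.Matrix"
begin

definition relu :: "real \<Rightarrow> real" where
  "relu s = max 0 s"

definition sat :: "real \<Rightarrow> real" where
  "sat s = max (- 1) (min s 1)"

text \<open>A (deterministic, time-invariant) feedback controller with internal states of type
  \<open>'s\<close>.  At every time it reads the plant state, emits the input \<open>out\<close>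
  and moves to its next internal state \<open>upd\<close>.  The initial internal state is part of the
  controller and hence does not depend on the initial plant state.\<close>

record 's controller =
  init :: 's
  upd :: "'s \<Rightarrow> real \<Rightarrow> 's"
  out :: "'s \<Rightarrow> real \<Rightarrow> real"

definition plant :: "real \<Rightarrow> real \<Rightarrow> real" where
  "plant x u = 3 / 2 * x + u"

primrec closed_loop :: "'s controller \<Rightarrow> real \<Rightarrow> nat \<Rightarrow> real \<times> 's" where
  "closed_loop \<pi> x0 0 = (x0, init \<pi>)"
| "closed_loop \<pi> x0 (Suc k) =
     (let (x, \<xi>) = closed_loop \<pi> x0 k in (plant x (out \<pi> \<xi> x), upd \<pi> \<xi> x))"

definition state_at :: "'s controller \<Rightarrow> real \<Rightarrow> nat \<Rightarrow> real" where
  "state_at \<pi> x0 k = fst (closed_loop \<pi> x0 k)"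

definition input_at :: "'s controller \<Rightarrow> real \<Rightarrow> nat \<Rightarrow> real" where
  "input_at \<pi> x0 k = (let (x, \<xi>) = closed_loop \<pi> x0 k in out \<pi> \<xi> x)"

definition admissible :: "'s controller \<Rightarrow> bool" where
  "admissible \<pi> \<longleftrightarrow> (\<forall>x0\<in>{-1..1}. \<forall>k. \<bar>input_at \<pi> x0 k\<bar> \<le> 1)"

definition cost :: "real \<Rightarrow> real \<Rightarrow> 's controller \<Rightarrow> ennreal" where
  "cost \<beta> r \<pi> =
     (\<integral>\<^sup>+ x0. (\<Sum>k. ennreal (\<beta> ^ k * ((state_at \<pi> x0 k)\<^sup>2 + r * (input_at \<pi> x0 k)\<^sup>2)))
       \<partial>uniform_measure lborel {-1..1})"

definition static_controller :: "(real \<Rightarrow> real) \<Rightarrow> unit controller" where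
  "static_controller g = \<lparr>init = (), upd = (\<lambda>_ _. ()), out = (\<lambda>_ x. g x)\<rparr>"

definition relu_feedback :: "real \<Rightarrow> real" where
  "relu_feedback x = 1 - relu (3 / 2 * x + 1) + relu (3 / 2 * x - 1)"

text \<open>The plant has scalar state and input, so \<open>B\<close> (a column) and \<open>C\<close> (a row) are given as
  vectors and \<open>D\<close> as a number.\<close>

definition linear_controller ::
  "real Matrix.mat \<Rightarrow> real Matrix.vec \<Rightarrow> real Matrix.vec \<Rightarrow> real \<Rightarrow> real Matrix.vec
    \<Rightarrow> real Matrix.vec controller" where
  "linear_controller A B C D \<xi>0 =
     \<lparr>init = \<xi>0,
      upd = (\<lambda>\<xi> x. A *\<^sub>v \<xi> + x \<cdot>\<^sub>v B),
      out = (\<lambda>\<xi> x. scalar_prod C \<xi> + D * x)\<rparr>"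

text \<open>The order \<open>n\<close> is arbitrary; \<open>n = 0\<close> gives the static linear gains.\<close>

definition dynamic_linear :: "real Matrix.vec controller \<Rightarrow> bool" where
  "dynamic_linear \<pi> \<longleftrightarrow>
     (\<exists>n A B C D \<xi>0. A \<in> carrier_mat n n \<and> B \<in> carrier_vec n \<and> C \<in> carrier_vec n \<and>
        \<xi>0 \<in> carrier_vec n \<and> \<pi> = linear_controller A B C D \<xi>0)"

end

theory Submission imports Defs begin

text \<open>The first input of an admissible linear controller is an affine function \<open>a + b * x0\<close> bounded
  by 1 on \<open>[-1, 1]\<close>, so \<open>\<bar>b\<bar> \<le> 1\<close>, and the first two stages alone cost
  \<open>1/3 + r * (a\<^sup>2 + b\<^sup>2/3) + \<beta> * ((3/2 + b)\<^sup>2/3 + a\<^sup>2)\<close>. For \<open>r \<le> \<beta>/2\<close> this convex function is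
  increasing in \<open>b \<in> [-1, 1]\<close>, so its minimum is at \<open>a = 0\<close>, \<open>b = -1\<close>. The saturated feedback brings
  every initial state to \<open>0\<close> in two steps, hence its cost is an explicit integral.\<close>

text \<open>Reduces an expectation over a uniform initial state to an integral computable by
  antiderivatives; \<open>b - a\<close> is the normalising length. Extending \<open>f\<close> by
  zero lets nonnegativity be assumed on the interval only.\<close>

lemma nn_integral_uniform_Icc:
  fixes f :: "real \<Rightarrow> real" and a b I :: real
  assumes "a < b" and [measurable]: "f \<in> borel_measurable borel"
    and nonneg: "\<And>x. x \<in> {a..b} \<Longrightarrow> 0 \<le> f x"
    and int: "(f has_integral I) {a..b}"
  shows "(\<integral>\<^sup>+ x. ennreal (f x) \<partial>uniform_measure lborel {a..b}) = ennreal (I / (b - a))"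
proof -
  have I: "0 \<le> I"
    using has_integral_nonneg[OF int] nonneg by auto
  have "((\<lambda>x. if x \<in> {a..b} then f x else 0) has_integral I) UNIV"
    using int by (simp only: has_integral_restrict_UNIV)
  then have "(\<integral>\<^sup>+ x. ennreal (if x \<in> {a..b} then f x else 0) \<partial>lborel) = ennreal I"
    by (intro nn_integral_has_integral_lborel) (use nonneg in auto)
  moreover have "(\<integral>\<^sup>+ x. ennreal (f x) * indicator {a..b} x \<partial>lborel)
      = (\<integral>\<^sup>+ x. ennreal (if x \<in> {a..b} then f x else 0) \<partial>lborel)"
    by (intro nn_integral_cong) (auto simp: indicator_def)
  ultimately show ?thesis
    using \<open>a < b\<close> I by (subst nn_integral_uniform_measure) (auto simp: divide_ennreal)
qed

text \<open>The integrands below are quadratic, at least piecewise, so this closed form serves both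
  the exact cost and the lower bound.\<close>

lemma has_integral_quadratic:
  fixes a b p q s :: real
  assumes "a \<le> b"
  shows "((\<lambda>x. p * x\<^sup>2 + q * x + s) has_integral
    (p * (b ^ 3 - a ^ 3) / 3 + q * (b\<^sup>2 - a\<^sup>2) / 2 + s * (b - a))) {a..b}"
proof -
  have "((\<lambda>x. p * x\<^sup>2 + q * x + s) has_integral
    ((p * b ^ 3 / 3 + q * b\<^sup>2 / 2 + s * b) - (p * a ^ 3 / 3 + q * a\<^sup>2 / 2 + s * a))) {a..b}"
    using assms
    by (intro fundamental_theorem_of_calculus)
       (auto intro!: derivative_eq_intros
          simp: has_real_derivative_iff_has_vector_derivative[symmetric] power2_eq_square)
  then show ?thesis
    by (rule has_integral_eq_rhs) (simp add: algebra_simps diff_divide_distrib)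
qed

lemma state_at_0 [simp]: "state_at \<pi> x 0 = x"
  by (simp add: state_at_def)

lemma state_at_Suc: "state_at \<pi> x (Suc k) = plant (state_at \<pi> x k) (input_at \<pi> x k)"
  by (simp add: state_at_def input_at_def split_beta)

lemma input_at_0: "input_at \<pi> x 0 = out \<pi> (init \<pi>) x"
  by (simp add: input_at_def)

lemma input_at_static: "input_at (static_controller g) x k = g (state_at (static_controller g) x k)"
  by (simp add: input_at_def state_at_def static_controller_def split_beta)

lemma relu_feedback_eq: "relu_feedback x = - sat (3 / 2 * x)"
  by (auto simp: relu_feedback_def relu_def sat_def max_def min_def)

lemma input_at_relu_feedback:
  "input_at (static_controller relu_feedback) x k
    = - sat (3 / 2 * state_at (static_controller relu_feedback) x k)"
  unfolding input_at_static by (rule relu_feedback_eq)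

lemma admissible_relu_feedback: "admissible (static_controller relu_feedback)"
  by (auto simp: admissible_def input_at_relu_feedback sat_def)

text \<open>If \<open>\<bar>x\<bar> \<le> 2/3\<close>, the first input cancels
  \<open>3/2 * x\<close> exactly. Otherwise the next state has modulus
  \<open>3/2 * \<bar>x\<bar> - 1 \<le> 1/2\<close>, where the feedback is unsaturated and cancels it
  one step later. Since \<open>sat 0 = 0\<close>, the origin is then never left.\<close>

lemma state_at_relu_feedback_eq_0:
  assumes "x \<in> {-1..1}"
  shows "state_at (static_controller relu_feedback) x (Suc (Suc k)) = 0"
proof (induction k)
  case 0
  then show ?case
    using assms
    by (auto simp: state_at_Suc input_at_relu_feedback plant_def sat_def max_def min_def)
next
  case (Suc k)
  then show ?case
    by (simp add: state_at_Suc[of _ _ "Suc (Suc k)"] input_at_relu_feedback plant_def sat_def)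
qed

lemma cost_relu_feedback:
  assumes "0 < \<beta>" and "0 \<le> r"
  shows "cost \<beta> r (static_controller relu_feedback)
    = ennreal (1 / 3 + \<beta> / 36 + r * (5 / 9 + \<beta> / 16))"
proof -
  let ?\<pi> = "static_controller relu_feedback"
  \<comment> \<open>The costs of stages 0 and 1. The second input is \<open>- 3/2\<close> times the
    second state, whence the factor \<open>1 + 9/4 * r\<close>.\<close>
  define f :: "real \<Rightarrow> real" where "f = (\<lambda>x. x\<^sup>2 + r * (sat (3 / 2 * x))\<^sup>2
    + \<beta> * (1 + 9 / 4 * r) * (3 / 2 * x - sat (3 / 2 * x))\<^sup>2)"
  have sum_eq: "(\<Sum>k. ennreal (\<beta> ^ k * ((state_at ?\<pi> x k)\<^sup>2 + r * (input_at ?\<pi> x k)\<^sup>2)))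
      = ennreal (f x)" (is "(\<Sum>k. ?t k) = _") if x: "x \<in> {-1..1}" for x
  proof -
    have "?t k = 0" if "k \<notin> {0, 1}" for k
    proof -
      from that have "k = Suc (Suc (k - 2))"
        by auto
      then have "state_at ?\<pi> x k = 0"
        using state_at_relu_feedback_eq_0[OF x] by metis
      then show ?thesis
        by (simp add: input_at_relu_feedback sat_def)
    qed
    then have "(\<Sum>k. ?t k) = sum ?t {0, 1}"
      by (intro suminf_finite) auto
    also have "\<dots> = ennreal (x\<^sup>2 + r * (sat (3 / 2 * x))\<^sup>2
        + \<beta> * ((state_at ?\<pi> x 1)\<^sup>2 + r * (input_at ?\<pi> x 1)\<^sup>2))"
      using assms by (simp add: ennreal_plus[symmetric] input_at_relu_feedback del: ennreal_plus)
    \<comment> \<open>The state at time 1 has modulus at most 1/2, so saturation is inactive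
      there.\<close>
    also have "input_at ?\<pi> x 1 = - (3 / 2) * state_at ?\<pi> x 1"
      using x by (auto simp: state_at_Suc input_at_relu_feedback plant_def sat_def max_def min_def)
    also have "state_at ?\<pi> x 1 = 3 / 2 * x - sat (3 / 2 * x)"
      by (simp add: state_at_Suc input_at_relu_feedback plant_def)
    finally show ?thesis
      by (simp add: f_def power_mult_distrib power2_eq_square algebra_simps)
  qed
  have "cost \<beta> r ?\<pi> = (\<integral>\<^sup>+ x. ennreal (f x) \<partial>uniform_measure lborel {-1..1})"
    unfolding cost_def using sum_eq
    by (intro nn_integral_cong_AE AE_uniform_measureI) auto
  also have "\<dots> = ennreal (2 * (1 / 3 + \<beta> / 36 + r * (5 / 9 + \<beta> / 16)) / (1 - (-1)))"
  proof (rule nn_integral_uniform_Icc)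
    let ?c = "\<beta> * (1 + 9 / 4 * r)"
    \<comment> \<open>On a saturated piece \<open>sat\<close> is a constant sign \<open>s\<close>,
      so \<open>f\<close> is a quadratic; keeping \<open>s\<close> symbolic treats both sides at
      once.\<close>
    have outer: "(f has_integral ((1 + 9 / 4 * ?c) * (b ^ 3 - a ^ 3) / 3
        + (- 3 * s * ?c) * (b\<^sup>2 - a\<^sup>2) / 2 + (r + ?c) * (b - a))) {a..b}"
      if "a \<le> b" "s\<^sup>2 = 1" "\<And>x. x \<in> {a..b} \<Longrightarrow> sat (3 / 2 * x) = s" for a b s
    proof (rule has_integral_eq[OF _ has_integral_quadratic[OF \<open>a \<le> b\<close>]])
      fix x assume "x \<in> {a..b}"
      then have "f x = x\<^sup>2 + r * s\<^sup>2 + ?c * (9 / 4 * x\<^sup>2 - 3 * s * x + s\<^sup>2)"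
        using that(3) by (simp add: f_def power2_eq_square algebra_simps)
      then show "(1 + 9 / 4 * ?c) * x\<^sup>2 + - 3 * s * ?c * x + (r + ?c) = f x"
        unfolding that(2) by (simp add: algebra_simps)
    qed
    \<comment> \<open>Between the breakpoints the state at time 1 is 0 and only stage 0 contributes.
      The zero coefficients match the general quadratic.\<close>
    have inner: "(f has_integral ((1 + 9 / 4 * r) * ((2/3) ^ 3 - (- 2/3) ^ 3) / 3
        + 0 * ((2/3)\<^sup>2 - (- 2/3)\<^sup>2) / 2 + 0 * (2/3 - - 2/3))) {- 2/3..2/3}"
    proof (rule has_integral_eq[OF _ has_integral_quadratic])
      fix x :: real assume "x \<in> {- 2/3..2/3}"
      then have sat: "sat (3 / 2 * x) = 3 / 2 * x"
        by (auto simp: sat_def)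
      show "(1 + 9 / 4 * r) * x\<^sup>2 + 0 * x + 0 = f x"
        unfolding f_def sat by (simp add: power2_eq_square algebra_simps)
    qed simp
    have left: "sat (3 / 2 * x) = - 1" if "x \<in> {- 1..- 2/3}" for x
      using that by (auto simp: sat_def)
    have right: "sat (3 / 2 * x) = 1" if "x \<in> {2/3..1}" for x
      using that by (auto simp: sat_def)
    \<comment> \<open>The three pieces are glued at \<open>- 2/3\<close> and \<open>2/3\<close>. By
      symmetry the two saturated pieces contribute equally, which gives the doubled terms in the
      sum.\<close>
    note has_integral_combine[OF _ _ has_integral_combine[OF _ _
        outer[of "- 1" "- 2/3" "- 1", OF _ _ left] inner] outer[of "2/3" 1 1, OF _ _ right]]
    then have "(f has_integral 2 / 3 * ((1 + 9 / 4 * ?c) * (1 - (2/3) ^ 3))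
        - 3 * ?c * (1 - (2/3)\<^sup>2) + 2 / 3 * (r + ?c)
        + 2 / 3 * (1 + 9 / 4 * r) * (2/3) ^ 3) {-1..1}"
      by (rule has_integral_eq_rhs) (simp_all add: field_simps power2_eq_square power3_eq_cube)
    then show "(f has_integral 2 * (1 / 3 + \<beta> / 36 + r * (5 / 9 + \<beta> / 16))) {-1..1}"
      by (rule has_integral_eq_rhs) (simp add: algebra_simps power2_eq_square power3_eq_cube)
    show "f \<in> borel_measurable borel"
      unfolding f_def sat_def by measurable
    show "0 \<le> f x" for x
      using assms by (simp add: f_def)
  qed simp
  also have "\<dots> = ennreal (1 / 3 + \<beta> / 36 + r * (5 / 9 + \<beta> / 16))"
    by (rule arg_cong[where f = ennreal]) simp
  finally show ?thesis .
qed

text \<open>The slope is half the difference of the values at 1 and -1.\<close>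

lemma abs_slope_le_1:
  fixes a b :: real
  assumes "\<forall>x\<in>{-1..1}. \<bar>a + b * x\<bar> \<le> 1"
  shows "\<bar>b\<bar> \<le> 1"
  using bspec[OF assms, of 1] bspec[OF assms, of "- 1"] by auto

text \<open>An affine first input determines the state at time 1. The second input cost and all
  later stages are dropped, being nonnegative. Cross terms between \<open>a\<close> and
  \<open>x\<close> are odd and integrate to zero, which separates \<open>a\<close> from
  \<open>b\<close>.\<close>

lemma cost_ge_affine_first_input:
  assumes "0 < \<beta>" and "0 \<le> r" and out: "\<And>x. out \<pi> (init \<pi>) x = a + b * x"
  shows "ennreal (1 / 3 + r * (a\<^sup>2 + b\<^sup>2 / 3) + \<beta> * ((3 / 2 + b)\<^sup>2 / 3 + a\<^sup>2)) \<le> cost \<beta> r \<pi>"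
proof -
  define f :: "real \<Rightarrow> real"
    where "f = (\<lambda>x. x\<^sup>2 + r * (a + b * x)\<^sup>2 + \<beta> * (3 / 2 * x + (a + b * x))\<^sup>2)"
  have f_quadratic: "f = (\<lambda>x. (1 + r * b\<^sup>2 + \<beta> * (3 / 2 + b)\<^sup>2) * x\<^sup>2
      + (2 * r * a * b + 2 * \<beta> * a * (3 / 2 + b)) * x + (r * a\<^sup>2 + \<beta> * a\<^sup>2))"
    by (simp add: f_def fun_eq_iff power2_eq_square algebra_simps)
  have "ennreal (1 / 3 + r * (a\<^sup>2 + b\<^sup>2 / 3) + \<beta> * ((3 / 2 + b)\<^sup>2 / 3 + a\<^sup>2))
      = ennreal (2 * (1 / 3 + r * (a\<^sup>2 + b\<^sup>2 / 3) + \<beta> * ((3 / 2 + b)\<^sup>2 / 3 + a\<^sup>2)) / (1 - (-1)))"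
    by (rule arg_cong[where f = ennreal]) simp
  also have "\<dots> = (\<integral>\<^sup>+ x. ennreal (f x) \<partial>uniform_measure lborel {-1..1})"
  proof (rule nn_integral_uniform_Icc[symmetric])
    show "(f has_integral 2 * (1 / 3 + r * (a\<^sup>2 + b\<^sup>2 / 3) + \<beta> * ((3 / 2 + b)\<^sup>2 / 3 + a\<^sup>2))) {-1..1}"
      unfolding f_quadratic
      by (rule has_integral_eq_rhs[OF has_integral_quadratic]) (simp_all add: field_simps)
    show "f \<in> borel_measurable borel"
      unfolding f_def by measurable
    show "0 \<le> f x" for x
      using assms by (simp add: f_def)
  qed simp
  also have "\<dots> \<le> cost \<beta> r \<pi>"
    unfolding cost_def
  \<comment> \<open>The comparison is pointwise in the initial state and remains valid where the
    series diverges.\<close>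
  proof (rule nn_integral_mono)
    fix x :: real
    let ?t = "\<lambda>k. ennreal (\<beta> ^ k * ((state_at \<pi> x k)\<^sup>2 + r * (input_at \<pi> x k)\<^sup>2))"
    have "f x \<le> x\<^sup>2 + r * (a + b * x)\<^sup>2 + \<beta> * ((state_at \<pi> x 1)\<^sup>2 + r * (input_at \<pi> x 1)\<^sup>2)"
      using assms by (simp add: f_def state_at_Suc input_at_0 plant_def)
    then have "ennreal (f x) \<le> sum ?t {0, 1}"
      using assms by (simp add: ennreal_plus[symmetric] input_at_0 ennreal_leI del: ennreal_plus)
    also have "\<dots> \<le> (\<Sum>k. ?t k)"
      by (intro sum_le_suminf) auto
    finally show "ennreal (f x) \<le> (\<Sum>k. ?t k)" .
  qed
  finally show ?thesis .
qed

lemma cost_dynamic_linear_ge: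
  assumes "0 < \<beta>" and "0 \<le> r" and "r \<le> \<beta> / 2" and "dynamic_linear \<pi>" and "admissible \<pi>"
  shows "ennreal (1 / 3 + r / 3 + \<beta> / 12) \<le> cost \<beta> r \<pi>"
proof -
  \<comment> \<open>Here \<open>a\<close> is the scalar product of \<open>C\<close> with the fixed
    initial controller state, and \<open>b\<close> is \<open>D\<close>.\<close>
  obtain a b where out: "\<And>x. out \<pi> (init \<pi>) x = a + b * x"
    using \<open>dynamic_linear \<pi>\<close> by (auto simp: dynamic_linear_def linear_controller_def)
  then have "\<bar>b\<bar> \<le> 1"
    using \<open>admissible \<pi>\<close> by (intro abs_slope_le_1[of a]) (metis admissible_def input_at_0)
  \<comment> \<open>This product is three times the excess of the bound at \<open>a = 0\<close> over
    its value at \<open>b = - 1\<close>, because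
    \<open>(3/2 + b)^2 - 1/4 = (1 + b) * (2 + b)\<close>.\<close>
  then have "0 \<le> (1 + b) * (\<beta> * (2 + b) - r * (1 - b))"
  proof (intro mult_nonneg_nonneg)
    have "r * (1 - b) \<le> \<beta> / 2 * (1 - b)"
      using assms \<open>\<bar>b\<bar> \<le> 1\<close> by (intro mult_right_mono) auto
    \<comment> \<open>The difference of the two sides is
      \<open>3/2 * \<beta> * (1 + b)\<close>.\<close>
    also have "\<dots> \<le> \<beta> * (2 + b)"
    proof -
      have "0 \<le> \<beta> * (1 + b)"
        using assms \<open>\<bar>b\<bar> \<le> 1\<close> by (intro mult_nonneg_nonneg) auto
      then show ?thesis
        by (simp add: field_simps)
    qed
    finally show "0 \<le> \<beta> * (2 + b) - r * (1 - b)"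
      by simp
  qed auto
  then have "r / 3 + \<beta> / 12 \<le> r * (b\<^sup>2 / 3) + \<beta> * ((3 / 2 + b)\<^sup>2 / 3)"
    by (simp add: power2_eq_square field_simps)
  moreover have "0 \<le> r * a\<^sup>2" "0 \<le> \<beta> * a\<^sup>2"
    using assms by auto
  ultimately have "1 / 3 + r / 3 + \<beta> / 12
      \<le> 1 / 3 + r * (a\<^sup>2 + b\<^sup>2 / 3) + \<beta> * ((3 / 2 + b)\<^sup>2 / 3 + a\<^sup>2)"
    unfolding distrib_left by linarith
  then show ?thesis
    using cost_ge_affine_first_input[OF assms(1,2) out] by (meson ennreal_leI order_trans)
qed

theorem theorem7:
  fixes \<beta> r :: real
  assumes "0 < \<beta>" and "\<beta> \<le> 1" and "0 \<le> r"
  shows "(\<forall>x. relu_feedback x = - sat (3 / 2 * x)) \<and>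
    admissible (static_controller relu_feedback) \<and>
    cost \<beta> r (static_controller relu_feedback)
      = ennreal (1 / 3 + \<beta> / 36 + r * (5 / 9 + \<beta> / 16)) \<and>
    (r \<le> \<beta> / 2 \<longrightarrow>
      (\<forall>\<pi>. dynamic_linear \<pi> \<and> admissible \<pi> \<longrightarrow>
        cost \<beta> r \<pi> \<ge> ennreal (1 / 3 + r / 3 + \<beta> / 12))) \<and>
    (r < 8 * \<beta> / (32 + 9 * \<beta>) \<longrightarrow>
      (\<forall>\<pi>. dynamic_linear \<pi> \<and> admissible \<pi> \<longrightarrow>
        cost \<beta> r (static_controller relu_feedback) < cost \<beta> r \<pi>)) \<and>
    (\<beta> = 1 \<longrightarrow> (r < 8 * \<beta> / (32 + 9 * \<beta>) \<longleftrightarrow> r < 8 / 41))"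
proof -
  have "cost \<beta> r (static_controller relu_feedback) < cost \<beta> r \<pi>"
    if r: "r < 8 * \<beta> / (32 + 9 * \<beta>)" and \<pi>: "dynamic_linear \<pi>" "admissible \<pi>" for \<pi>
  proof -
    have bound: "r * (32 + 9 * \<beta>) < 8 * \<beta>"
      using r assms by (simp add: pos_less_divide_eq)
    have "0 \<le> r * \<beta>"
      using assms by simp
    moreover have "r * (32 + 9 * \<beta>) = 32 * r + 9 * (r * \<beta>)"
      by (simp add: algebra_simps)
    \<comment> \<open>Dropping \<open>9 * (r * \<beta>)\<close> even gives
      \<open>r < \<beta> / 4\<close>, so the lower bound for linear controllers applies.\<close>
    ultimately have "r \<le> \<beta> / 2"
      using bound assms by linarith
    \<comment> \<open>Right side minus left side is
      \<open>(8 * \<beta> - r * (32 + 9 * \<beta>)) / 144\<close>, which is where the threshold on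
      \<open>r\<close> comes from.\<close>
    have "1 / 3 + \<beta> / 36 + r * (5 / 9 + \<beta> / 16) < 1 / 3 + r / 3 + \<beta> / 12"
      using bound by (simp add: field_simps)
    then have "cost \<beta> r (static_controller relu_feedback) < ennreal (1 / 3 + r / 3 + \<beta> / 12)"
      using assms by (simp add: cost_relu_feedback ennreal_less_iff del: ennreal_plus)
    also have "\<dots> \<le> cost \<beta> r \<pi>"
      using assms \<open>r \<le> \<beta> / 2\<close> \<pi> by (intro cost_dynamic_linear_ge)
    finally show ?thesis .
  qed
  then show ?thesis
    using assms cost_dynamic_linear_ge
    by (simp add: relu_feedback_eq admissible_relu_feedback cost_relu_feedback)
qed

end
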